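(* Let $\alpha\in(0,1]$, $\lambda>0$. The distribution $p_k(t;\alpha,1)=\Pr\{N(\mathfrak{A}^\alpha_t)=k\}$ of $N(\mathfrak{A}^\alpha_t)$ is the solution to the equation $$\left(\frac{d^{1/\alpha}}{d(-t)^{1/\alpha}}-\lambda(I-B)\right)p_k(t;\alpha,1)=0,\qquad k=0,1,2,\ldots,\ t>0,$$ subject to the initial conditions $p_0(0;\alpha,1)=1$, $p_k(0;\alpha,1)=0$ for $k\ge1$, and $$\left.\frac{d^j}{dt^j}p_k(t;\alpha,1)\right|_{t=0}=(-1)^{k}\,\frac{\lambda^{\alpha j}}{k!}\,\frac{\Gamma(\alpha j+1)}{\Gamma(\alpha j+1-k)},\qquad j=1,\ldots,\lfloor1/\alpha\rfloor-1.$$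
   Context: $N$ is a homogeneous Poisson process of rate $\lambda$, independent of $\mathfrak{A}^\alpha$, which for $\alpha\in(0,1)$ is an $\alpha$-stable subordinator with $\mathbb{E}e^{-\xi\mathfrak{A}^\alpha_t}=e^{-t\xi^\alpha}$, and $\mathfrak{A}^1_t=t$. $B$ is the backward shift in $k$, $Bu_k=u_{k-1}$, with $u_{-1}=0$. The fractional derivative is $$\frac{d^\nu}{d(-x)^\nu}f(x)=\frac1{\Gamma(m-\nu)}\left(-\frac{d}{dx}\right)^m\int_x^{+\infty}\frac{f(s)\,ds}{(s-x)^{1+\nu-m}},\qquad m-1<\nu<m,$$ and, as usual, $\left(-\frac{d}{dx}\right)^m$ when $\nu=m$ is an integer.
   Formalization: The factor (-1)^k in the initial conditions for the j-th derivatives is corrected to (-1)^{k+j}: as printed it fails for odd j, e.g. p_0(t)=exp(-tλ^α) has p_0'(0)=-λ^α. "Is the solution" is read as satisfying the equation and the conditions. *)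

theory Defs
  imports "HOL-Probability.Probability"
begin

section \<open>Processes\<close>

text \<open>
  Real-valued processes indexed by time \<open>t \<ge> 0\<close>; the values at negative times are irrelevant.
  The path properties are required for every outcome, so that a process may be evaluated at a
  random time.
\<close>

definition nondecreasing_levy_process :: "'a measure \<Rightarrow> (real \<Rightarrow> 'a \<Rightarrow> real) \<Rightarrow> bool" where
  "nondecreasing_levy_process M X \<longleftrightarrow>
     (\<forall>t\<ge>0. X t \<in> borel_measurable M) \<and>
     (\<forall>\<omega>\<in>space M. X 0 \<omega> = 0) \<and>
     (\<forall>\<omega>\<in>space M. mono_on {0..} (\<lambda>t. X t \<omega>)) \<and>
     (\<forall>\<omega>\<in>space M. \<forall>t\<ge>0. continuous (at_right t) (\<lambda>s. X s \<omega>)) \<and>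
     (\<forall>s\<ge>0. \<forall>h\<ge>0. distr M borel (\<lambda>\<omega>. X (s + h) \<omega> - X s \<omega>) = distr M borel (X h)) \<and>
     (\<forall>(n::nat) t. 0 \<le> t 0 \<longrightarrow> mono t \<longrightarrow>
        prob_space.indep_vars M (\<lambda>_. borel) (\<lambda>i \<omega>. X (t (Suc i)) \<omega> - X (t i) \<omega>) {..<n})"

definition poisson_process :: "'a measure \<Rightarrow> real \<Rightarrow> (real \<Rightarrow> 'a \<Rightarrow> nat) \<Rightarrow> bool" where
  "poisson_process M rate N \<longleftrightarrow>
     nondecreasing_levy_process M (\<lambda>t \<omega>. real (N t \<omega>)) \<and>
     (\<forall>t>0. distr M (count_space UNIV) (N t) = measure_pmf (poisson_pmf (rate * t)))"

text \<open>For \<open>\<alpha> = 1\<close> the process is, by convention, the deterministic time \<open>t\<close>.\<close>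

definition stable_subordinator :: "'a measure \<Rightarrow> real \<Rightarrow> (real \<Rightarrow> 'a \<Rightarrow> real) \<Rightarrow> bool" where
  "stable_subordinator M \<alpha> A \<longleftrightarrow>
     (if \<alpha> = 1 then \<forall>t\<ge>0. \<forall>\<omega>\<in>space M. A t \<omega> = t
      else nondecreasing_levy_process M A \<and>
        (\<forall>t\<ge>0. \<forall>\<xi>\<ge>0. prob_space.expectation M (\<lambda>\<omega>. exp (- \<xi> * A t \<omega>)) = exp (- t * \<xi> powr \<alpha>)))"

text \<open>
  Independence of the \<open>\<sigma>\<close>-algebras generated by the two processes. The library's \<open>indep_var\<close>
  needs a common value type, hence the embedding of the counts into the reals.
\<close>

definition independent_processes ::
    "'a measure \<Rightarrow> (real \<Rightarrow> 'a \<Rightarrow> nat) \<Rightarrow> (real \<Rightarrow> 'a \<Rightarrow> real) \<Rightarrow> bool" where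
  "independent_processes M N A \<longleftrightarrow>
     prob_space.indep_var M
       (Pi\<^sub>M {0..} (\<lambda>_. borel)) (\<lambda>\<omega>. \<lambda>t\<in>{0..}. real (N t \<omega>))
       (Pi\<^sub>M {0..} (\<lambda>_. borel)) (\<lambda>\<omega>. \<lambda>t\<in>{0..}. A t \<omega>)"

definition subordinated_prob ::
    "'a measure \<Rightarrow> (real \<Rightarrow> 'a \<Rightarrow> nat) \<Rightarrow> (real \<Rightarrow> 'a \<Rightarrow> real) \<Rightarrow> nat \<Rightarrow> real \<Rightarrow> real" where
  "subordinated_prob M N A k t = measure M {\<omega> \<in> space M. N (A t \<omega>) \<omega> = k}"

section \<open>Operators\<close>

definition backward_shift :: "(nat \<Rightarrow> real) \<Rightarrow> nat \<Rightarrow> real" where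
  "backward_shift u k = (if k = 0 then 0 else u (k - 1))"

text \<open>
  \<open>nth_deriv_on n S f D\<close>: the function \<open>f\<close> is \<open>n\<close> times differentiable on \<open>S\<close> with \<open>n\<close>-th
  derivative \<open>D\<close>; derivatives are taken within \<open>S\<close>, hence one-sided at the end point of \<open>{0..}\<close>.
\<close>

primrec nth_deriv_on :: "nat \<Rightarrow> real set \<Rightarrow> (real \<Rightarrow> real) \<Rightarrow> (real \<Rightarrow> real) \<Rightarrow> bool" where
  "nth_deriv_on 0 S f D \<longleftrightarrow> (\<forall>x\<in>S. D x = f x)"
| "nth_deriv_on (Suc n) S f D \<longleftrightarrow>
     (\<exists>f'. (\<forall>x\<in>S. (f has_real_derivative f' x) (at x within S)) \<and> nth_deriv_on n S f' D)"

text \<open>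
  \<open>right_frac_deriv \<nu> f D\<close>: on \<open>{0<..}\<close>, the derivative of \<open>f\<close> of order \<open>\<nu> > 0\<close> with respect to
  \<open>-x\<close> exists (in particular the integral converges absolutely and is \<open>m\<close> times
  differentiable) and equals \<open>D\<close>. With \<open>m = \<lceil>\<nu>\<rceil>\<close>, the condition \<open>\<nu> = m\<close> says that \<open>\<nu>\<close> is an integer.
\<close>

definition right_frac_deriv :: "real \<Rightarrow> (real \<Rightarrow> real) \<Rightarrow> (real \<Rightarrow> real) \<Rightarrow> bool" where
  "right_frac_deriv \<nu> f D \<longleftrightarrow>
     (let m = nat \<lceil>\<nu>\<rceil> in
      if \<nu> = real m then
        \<exists>E. nth_deriv_on m {0<..} f E \<and> (\<forall>x>0. D x = (-1) ^ m * E x)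
      else
        (\<forall>x>0. set_integrable lborel {x<..} (\<lambda>s. f s / (s - x) powr (1 + \<nu> - real m))) \<and>
        (\<exists>E. nth_deriv_on m {0<..}
               (\<lambda>x. set_lebesgue_integral lborel {x<..}
                      (\<lambda>s. f s / (s - x) powr (1 + \<nu> - real m))) E \<and>
             (\<forall>x>0. D x = 1 / Gamma (real m - \<nu>) * ((-1) ^ m * E x))))"

end

theory Submission
  imports Defs
begin

text \<open>
  Conditioning on the subordinator gives, from its Laplace transform, the generating function
  \<open>\<Sum>k. p\<^sub>k(t) u^k = exp (- c t (1 - u)^\<alpha>)\<close> with \<open>c = \<lambda>^\<alpha>\<close>. Read as a formal power series \<open>E(t)\<close> in
  \<open>u\<close> with coefficients depending on \<open>t\<close>, it turns \<open>-d/dt\<close> into multiplication by \<open>c (1 - u)^\<alpha>\<close>, and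
  the fractional integral of order \<open>\<beta>\<close> into multiplication by \<open>c^(-\<beta>) (1 - u)^(-\<alpha> \<beta>)\<close> (a Gamma
  integral, coefficient by coefficient). Hence the derivative of order \<open>1/\<alpha>\<close> is multiplication by
  \<open>\<lambda> (1 - u)\<close>, which is the symbol of \<open>\<lambda> (I - B)\<close>, and the derivatives at \<open>0\<close> are the
  binomial coefficients of \<open>(- c)^j (1 - u)^(\<alpha> j)\<close>.
\<close>

unbundle no vec_syntax
unbundle fps_syntax

section \<open>A Poisson process at an independent random time\<close>

text \<open>Split the event over the values \<open>j\<close> of \<open>J\<close>: independence
  factors each piece, and the sum of the products is the integral of a function of \<open>J\<close>
  with countably many values. On the right the index is frozen at the outer outcome while the law is
  taken in \<open>\<omega>'\<close>.\<close>

lemma (in prob_space) prob_countable_random_index: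
  fixes J :: "'a \<Rightarrow> nat" and X :: "nat \<Rightarrow> 'a \<Rightarrow> 'b"
  assumes [measurable]: "J \<in> measurable M (count_space UNIV)"
    and [measurable]: "\<And>j. X j \<in> measurable M (count_space UNIV)"
    and indep: "\<And>j. prob {\<omega>\<in>space M. X j \<omega> = k \<and> J \<omega> = j} =
                     prob {\<omega>\<in>space M. X j \<omega> = k} * prob {\<omega>\<in>space M. J \<omega> = j}"
  shows "prob {\<omega>\<in>space M. X (J \<omega>) \<omega> = k} =
           expectation (\<lambda>\<omega>. prob {\<omega>'\<in>space M. X (J \<omega>) \<omega>' = k})"
proof -
  let ?q = "\<lambda>j. prob {\<omega>\<in>space M. X j \<omega> = k}"
  have "(\<lambda>j. prob ({\<omega>\<in>space M. X j \<omega> = k \<and> J \<omega> = j})) sums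
          prob (\<Union>j. {\<omega>\<in>space M. X j \<omega> = k \<and> J \<omega> = j})"
    by (rule finite_measure_UNION) (auto simp: disjoint_family_on_def)
  also have "(\<Union>j. {\<omega>\<in>space M. X j \<omega> = k \<and> J \<omega> = j}) = {\<omega>\<in>space M. X (J \<omega>) \<omega> = k}"
    by auto
  finally have 1: "(\<lambda>j. ?q j * prob {\<omega>\<in>space M. J \<omega> = j}) sums prob {\<omega>\<in>space M. X (J \<omega>) \<omega> = k}"
    by (simp add: indep)
  have int: "integrable M (\<lambda>\<omega>. ?q j * indicator {\<omega>\<in>space M. J \<omega> = j} \<omega>)" for j
    by (intro integrable_mult_right integrable_real_indicator) (auto simp: emeasure_eq_measure)
  have eq: "(\<lambda>j. ?q j * indicator {\<omega>\<in>space M. J \<omega> = j} \<omega>) sums ?q (J \<omega>)"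
    if "\<omega> \<in> space M" for \<omega>
  proof -
    have "(\<lambda>j. if j = J \<omega> then ?q j else 0) sums ?q (J \<omega>)"
      using sums_single[of "J \<omega>" ?q] by simp
    then show ?thesis
      by (rule sums_cong[THEN iffD1, rotated]) (use that in \<open>auto simp: indicator_def\<close>)
  qed
  have "(\<lambda>j. \<integral>\<omega>. ?q j * indicator {\<omega>\<in>space M. J \<omega> = j} \<omega> \<partial>M) sums
          (\<integral>\<omega>. (\<Sum>j. ?q j * indicator {\<omega>\<in>space M. J \<omega> = j} \<omega>) \<partial>M)"
  proof (rule sums_integral[OF int])
    show "AE \<omega> in M. summable (\<lambda>j. norm (?q j * indicator {\<omega>\<in>space M. J \<omega> = j} \<omega>))"
      using eq by (intro AE_I2) (simp add: sums_iff)
    show "summable (\<lambda>j. \<integral>\<omega>. norm (?q j * indicator {\<omega>\<in>space M. J \<omega> = j} \<omega>) \<partial>M)"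
      using 1 by (simp add: sums_iff)
  qed
  also have "(\<integral>\<omega>. (\<Sum>j. ?q j * indicator {\<omega>\<in>space M. J \<omega> = j} \<omega>) \<partial>M) = (\<integral>\<omega>. ?q (J \<omega>) \<partial>M)"
    using eq by (intro Bochner_Integration.integral_cong refl) (simp add: sums_iff)
  finally have 2: "(\<lambda>j. ?q j * prob {\<omega>\<in>space M. J \<omega> = j}) sums (\<integral>\<omega>. ?q (J \<omega>) \<partial>M)"
    by simp
  from sums_unique2[OF 1 2] show ?thesis .
qed

lemma poisson_process_measurable:
  assumes "poisson_process M rate N" and "0 \<le> s"
  shows "N s \<in> measurable M (count_space UNIV)"
proof -
  have "(\<lambda>\<omega>. real (N s \<omega>)) \<in> borel_measurable M"
    using assms by (simp add: poisson_process_def nondecreasing_levy_process_def)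
  \<comment> \<open>The process definition gives measurability only after embedding into the reals;
    \<open>nat\<close> of the floor undoes the embedding.\<close>
  then have "(\<lambda>\<omega>. nat \<lfloor>real (N s \<omega>)\<rfloor>) \<in> measurable M (count_space UNIV)"
    by measurable
  then show ?thesis by simp
qed

lemma poisson_process_prob:
  assumes "prob_space M" and "poisson_process M rate N" and "0 < rate" and "0 < s"
  shows "measure M {\<omega>\<in>space M. N s \<omega> = k} = (rate * s) ^ k / fact k * exp (- (rate * s))"
proof -
  interpret prob_space M by fact
  have "N s \<in> measurable M (count_space UNIV)"
    using assms by (intro poisson_process_measurable[OF assms(2)]) auto
  then have "measure M {\<omega>\<in>space M. N s \<omega> = k} = measure (distr M (count_space UNIV) (N s)) {k}"
    by (subst measure_distr) (auto intro!: arg_cong[where f = "measure M"])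
  also have "\<dots> = pmf (poisson_pmf (rate * s)) k"
    using assms by (simp add: poisson_process_def measure_pmf_single)
  finally show ?thesis
    using assms by (simp add: pmf_poisson)
qed

text \<open>Independence of \<open>T\<close> from each single \<open>N s\<close> suffices: once
  \<open>T\<close> is rounded to a grid, only countably many fixed times occur and
  \<open>prob_countable_random_index\<close> applies. Dominated convergence then carries both sides
  to the limit.\<close>

lemma poisson_process_random_time_prob:
  fixes T :: "'a \<Rightarrow> real"
  assumes "prob_space M" and N: "poisson_process M rate N" and "0 < rate"
    and T [measurable]: "T \<in> borel_measurable M" and T_nonneg: "\<And>\<omega>. \<omega> \<in> space M \<Longrightarrow> 0 \<le> T \<omega>"
    and indep: "\<And>s. s \<ge> 0 \<Longrightarrow> prob_space.indep_var M borel (\<lambda>\<omega>. real (N s \<omega>)) borel T"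
  shows "measure M {\<omega>\<in>space M. N (T \<omega>) \<omega> = k} =
           (\<integral>\<omega>. (rate * T \<omega>) ^ k / fact k * exp (- (rate * T \<omega>)) \<partial>M)"
proof -
  interpret prob_space M by fact
  define J where "J = (\<lambda>n \<omega>. nat \<lfloor>real (Suc n) * T \<omega>\<rfloor>)"
  \<comment> \<open>The numerator is \<open>j + 1\<close> rather than \<open>j\<close> so that every
    grid time exceeds the \<open>T\<close> rounded to it and is positive, the Poisson law being
    prescribed for positive times only.\<close>
  define g where "g = (\<lambda>n j. real (Suc j) / real (Suc n))"
  define S where "S = (\<lambda>n \<omega>. g n (J n \<omega>))"
  define q where "q = (\<lambda>s. (rate * s) ^ k / fact k * exp (- (rate * s)))"
  note N_meas = poisson_process_measurable[OF N]
  have N_cont: "continuous (at_right s) (\<lambda>s. real (N s \<omega>))" if "\<omega> \<in> space M" "s \<ge> 0" for \<omega> s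
    using N that by (simp add: poisson_process_def nondecreasing_levy_process_def)
  have g_pos: "g n j > 0" for n j by (simp add: g_def)
  have J_meas [measurable]: "J n \<in> measurable M (count_space UNIV)" for n
    unfolding J_def by measurable
  have S_meas [measurable]: "S n \<in> borel_measurable M" for n
    unfolding S_def g_def by measurable
  \<comment> \<open>\<open>S n\<close> takes countably many values and tends to \<open>T\<close> strictly from the right, so that right continuity of
    the paths of \<open>N\<close> suffices for the passage to the limit.\<close>
  have S_bounds: "T \<omega> < S n \<omega>" "S n \<omega> \<le> T \<omega> + 1 / real (Suc n)" if "\<omega> \<in> space M" for n \<omega>
  proof -
    have *: "real (J n \<omega>) = of_int \<lfloor>real (Suc n) * T \<omega>\<rfloor>"
      using T_nonneg[OF that] unfolding J_def by simp
    define m where "m = real (Suc n)"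
    have S_eq: "S n \<omega> = (real (J n \<omega>) + 1) / m"
      by (simp add: S_def g_def m_def)
    have "m > 0" by (simp add: m_def)
    moreover have "m * T \<omega> < real (J n \<omega>) + 1" "real (J n \<omega>) \<le> m * T \<omega>"
      using * unfolding m_def by linarith+
    ultimately have "T \<omega> < S n \<omega>" "S n \<omega> \<le> T \<omega> + 1 / m"
      unfolding S_eq by (simp_all add: field_simps)
    then show "T \<omega> < S n \<omega>" "S n \<omega> \<le> T \<omega> + 1 / real (Suc n)"
      by (simp_all add: m_def)
  qed
  have S_lim: "(\<lambda>n. S n \<omega>) \<longlonglongrightarrow> T \<omega>" if "\<omega> \<in> space M" for \<omega>
  proof (rule tendsto_sandwich[OF _ _ tendsto_const])
    show "\<forall>\<^sub>F n in sequentially. T \<omega> \<le> S n \<omega>"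
      using S_bounds(1)[OF that] by (auto intro!: always_eventually less_imp_le)
    show "\<forall>\<^sub>F n in sequentially. S n \<omega> \<le> T \<omega> + 1 / real (Suc n)"
      using S_bounds(2)[OF that] by (auto intro!: always_eventually)
    show "(\<lambda>n. T \<omega> + 1 / real (Suc n)) \<longlonglongrightarrow> T \<omega>"
      using tendsto_add[OF tendsto_const LIMSEQ_inverse_real_of_nat, of "T \<omega>"]
      by (simp add: inverse_eq_divide)
  qed
  have NS_lim: "(\<lambda>n. real (N (S n \<omega>) \<omega>)) \<longlonglongrightarrow> real (N (T \<omega>) \<omega>)" if "\<omega> \<in> space M" for \<omega>
  proof -
    have "filterlim (\<lambda>n. S n \<omega>) (at_right (T \<omega>)) sequentially"
      using S_lim[OF that] S_bounds(1)[OF that]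
      by (auto simp: filterlim_at less_imp_neq[THEN not_sym] intro!: always_eventually)
    then show ?thesis
      using N_cont[OF that T_nonneg[OF that]] unfolding continuous_within
      by (rule filterlim_compose[rotated])
  qed
  have NS_meas [measurable]: "(\<lambda>\<omega>. N (S n \<omega>) \<omega>) \<in> measurable M (count_space UNIV)" for n
    unfolding S_def
    by (rule measurable_compose_countable[OF _ J_meas]) (use N_meas g_pos in \<open>auto intro: less_imp_le\<close>)
  \<comment> \<open>The count at the random time is measurable as a pointwise limit of the counts at
    grid times.\<close>
  have NT_real: "(\<lambda>\<omega>. real (N (T \<omega>) \<omega>)) \<in> borel_measurable M"
    by (rule borel_measurable_LIMSEQ_real[OF NS_lim]) measurable
  have NT_meas [measurable]: "(\<lambda>\<omega>. N (T \<omega>) \<omega>) \<in> measurable M (count_space UNIV)"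
  proof -
    have "(\<lambda>\<omega>. nat \<lfloor>real (N (T \<omega>) \<omega>)\<rfloor>) \<in> measurable M (count_space UNIV)"
      using NT_real by measurable
    then show ?thesis by simp
  qed
  have q_meas [measurable]: "q \<in> borel_measurable borel"
    unfolding q_def by measurable
  have q_prob: "prob {\<omega>\<in>space M. N s \<omega> = k} = q s" if "s > 0" for s
    unfolding q_def by (rule poisson_process_prob) (use that assms in auto)
  have grid: "prob {\<omega>\<in>space M. N (S n \<omega>) \<omega> = k} = expectation (\<lambda>\<omega>. q (S n \<omega>))" for n
  proof -
    have "prob {\<omega>\<in>space M. N (g n (J n \<omega>)) \<omega> = k} =
           expectation (\<lambda>\<omega>. prob {\<omega>'\<in>space M. N (g n (J n \<omega>)) \<omega>' = k})"
    proof (rule prob_countable_random_index)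
      fix j
      show "N (g n j) \<in> measurable M (count_space UNIV)"
        using g_pos by (intro N_meas less_imp_le)
      \<comment> \<open>The event \<open>J n \<omega> = j\<close> is a Borel condition on
        \<open>T\<close> alone, so the joint event is a rectangle for the pair
        \<open>(N (g n j), T)\<close>.\<close>
      let ?B = "{x::real. nat \<lfloor>real (Suc n) * x\<rfloor> = j}"
      have [measurable]: "?B \<in> sets borel" by measurable
      have "prob ((\<lambda>\<omega>. (real (N (g n j) \<omega>), T \<omega>)) -` ({real k} \<times> ?B) \<inter> space M) =
            prob ((\<lambda>\<omega>. real (N (g n j) \<omega>)) -` {real k} \<inter> space M) * prob (T -` ?B \<inter> space M)"
        by (rule indep_varD[OF indep]) (use g_pos in \<open>auto intro: less_imp_le\<close>)
      also have "(\<lambda>\<omega>. (real (N (g n j) \<omega>), T \<omega>)) -` ({real k} \<times> ?B) \<inter> space M =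
          {\<omega>\<in>space M. N (g n j) \<omega> = k \<and> J n \<omega> = j}" by (auto simp: J_def)
      also have "(\<lambda>\<omega>. real (N (g n j) \<omega>)) -` {real k} \<inter> space M = {\<omega>\<in>space M. N (g n j) \<omega> = k}"
        by auto
      also have "T -` ?B \<inter> space M = {\<omega>\<in>space M. J n \<omega> = j}" by (auto simp: J_def)
      finally show "prob {\<omega>\<in>space M. N (g n j) \<omega> = k \<and> J n \<omega> = j} =
          prob {\<omega>\<in>space M. N (g n j) \<omega> = k} * prob {\<omega>\<in>space M. J n \<omega> = j}" .
    qed simp
    then show ?thesis
      by (simp add: S_def q_prob g_pos)
  qed
  have "(\<lambda>n. expectation (\<lambda>\<omega>. q (S n \<omega>))) \<longlonglongrightarrow> expectation (\<lambda>\<omega>. q (T \<omega>))"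
  proof (rule integral_dominated_convergence[where w = "\<lambda>_. 1"])
    show "AE \<omega> in M. (\<lambda>n. q (S n \<omega>)) \<longlonglongrightarrow> q (T \<omega>)"
      unfolding q_def using S_lim by (intro AE_I2 tendsto_intros) auto
    show "AE \<omega> in M. norm (q (S n \<omega>)) \<le> 1" for n
    proof (rule AE_I2)
      fix \<omega> assume "\<omega> \<in> space M"
      \<comment> \<open>The dominating constant 1 is available because \<open>q\<close> is a
        probability at positive times.\<close>
      have "q (S n \<omega>) = prob {\<omega>'\<in>space M. N (S n \<omega>) \<omega>' = k}"
        by (rule q_prob[symmetric]) (simp add: S_def g_pos)
      then show "norm (q (S n \<omega>)) \<le> 1" by simp
    qed
  qed simp_all
  moreover have "(\<lambda>n. expectation (\<lambda>\<omega>. indicator {\<omega>\<in>space M. N (S n \<omega>) \<omega> = k} \<omega>))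
      \<longlonglongrightarrow> expectation (\<lambda>\<omega>. indicator {\<omega>\<in>space M. N (T \<omega>) \<omega> = k} \<omega> :: real)"
  proof (rule integral_dominated_convergence[where w = "\<lambda>_. 1"])
    show "AE \<omega> in M. (\<lambda>n. indicator {\<omega>\<in>space M. N (S n \<omega>) \<omega> = k} \<omega> :: real) \<longlonglongrightarrow>
        indicator {\<omega>\<in>space M. N (T \<omega>) \<omega> = k} \<omega>"
    proof (rule AE_I2)
      fix \<omega> assume \<omega>: "\<omega> \<in> space M"
      \<comment> \<open>Natural numbers at distance less than 1 coincide, so the indicators are
        eventually constant along the sequence.\<close>
      have "\<forall>\<^sub>F n in sequentially. dist (real (N (S n \<omega>) \<omega>)) (real (N (T \<omega>) \<omega>)) < 1"
        using tendstoD[OF NS_lim[OF \<omega>]] by simp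
      then have "\<forall>\<^sub>F n in sequentially. indicator {\<omega>\<in>space M. N (T \<omega>) \<omega> = k} \<omega> =
          (indicator {\<omega>\<in>space M. N (S n \<omega>) \<omega> = k} \<omega> :: real)"
        by eventually_elim (auto simp: dist_real_def indicator_def)
      then show "(\<lambda>n. indicator {\<omega>\<in>space M. N (S n \<omega>) \<omega> = k} \<omega> :: real) \<longlonglongrightarrow>
        indicator {\<omega>\<in>space M. N (T \<omega>) \<omega> = k} \<omega>"
        by (rule Lim_transform_eventually[OF tendsto_const])
    qed
  qed (simp_all add: indicator_def)
  ultimately have "expectation (\<lambda>\<omega>. q (T \<omega>)) = prob {\<omega>\<in>space M. N (T \<omega>) \<omega> = k}"
    using grid by (simp add: LIMSEQ_unique)
  then show ?thesis by (simp add: q_def)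
qed

section \<open>The subordinator and the generating function\<close>

text \<open>For \<open>\<alpha> = 1\<close> the definition fixes the paths instead of asking for a
  Levy process, hence the case split in each claim.\<close>

lemma stable_subordinator_marginal:
  assumes "prob_space M" and "stable_subordinator M \<alpha> A" and "0 < \<alpha>" and "0 \<le> t"
  shows "A t \<in> borel_measurable M"
    and "\<And>\<omega>. \<omega> \<in> space M \<Longrightarrow> 0 \<le> A t \<omega>"
    and "\<And>\<xi>. 0 \<le> \<xi> \<Longrightarrow> (\<integral>\<omega>. exp (- \<xi> * A t \<omega>) \<partial>M) = exp (- t * \<xi> powr \<alpha>)"
proof -
  interpret prob_space M by fact
  show "A t \<in> borel_measurable M"
  proof (cases "\<alpha> = 1")
    case True
    then have "A t \<in> borel_measurable M \<longleftrightarrow> (\<lambda>_. t) \<in> borel_measurable M"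
      using assms by (intro measurable_cong) (auto simp: stable_subordinator_def)
    then show ?thesis by simp
  qed (use assms in \<open>auto simp: stable_subordinator_def nondecreasing_levy_process_def\<close>)
  show "0 \<le> A t \<omega>" if "\<omega> \<in> space M" for \<omega>
  proof (cases "\<alpha> = 1")
    case False
    then have "A 0 \<omega> = 0" "mono_on {0..} (\<lambda>t. A t \<omega>)"
      using assms that by (auto simp: stable_subordinator_def nondecreasing_levy_process_def)
    then show ?thesis
      using \<open>0 \<le> t\<close> mono_onD[of "{0..}" "\<lambda>t. A t \<omega>" 0 t] by auto
  qed (use assms that in \<open>auto simp: stable_subordinator_def\<close>)
  show "(\<integral>\<omega>. exp (- \<xi> * A t \<omega>) \<partial>M) = exp (- t * \<xi> powr \<alpha>)" if "0 \<le> \<xi>" for \<xi>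
  proof (cases "\<alpha> = 1")
    case True
    then have "(\<integral>\<omega>. exp (- \<xi> * A t \<omega>) \<partial>M) = (\<integral>\<omega>. exp (- \<xi> * t) \<partial>M)"
      using assms by (intro Bochner_Integration.integral_cong) (auto simp: stable_subordinator_def)
    then show ?thesis using True that by (simp add: prob_space)
  qed (use assms that in \<open>auto simp: stable_subordinator_def\<close>)
qed

text \<open>Evaluation at a fixed time is a measurable coordinate map on path space, so independence
  of whole paths passes to single times.\<close>

lemma independent_processes_marginals:
  assumes "prob_space M" and "independent_processes M N A" and "0 \<le> s" and "0 \<le> t"
  shows "prob_space.indep_var M borel (\<lambda>\<omega>. real (N s \<omega>)) borel (A t)"
proof -
  interpret prob_space M by fact
  have "indep_var borel ((\<lambda>f. f s) \<circ> (\<lambda>\<omega>. \<lambda>t\<in>{0..}. real (N t \<omega>)))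
                  borel ((\<lambda>f. f t) \<circ> (\<lambda>\<omega>. \<lambda>t\<in>{0..}. A t \<omega>))"
    by (rule indep_var_compose[OF assms(2)[unfolded independent_processes_def]])
       (use assms in \<open>auto intro!: measurable_component_singleton\<close>)
  then show ?thesis using assms by (simp add: o_def)
qed

text \<open>Given the subordinator, the count has Poisson generating function
  \<open>exp (- rate * (1 - u) * A t \<omega>)\<close>; its expectation is the Laplace transform at
  \<open>\<xi> = rate * (1 - u)\<close>. The geometric series in \<open>\<bar>u\<bar>\<close>
  justifies exchanging sum and expectation.\<close>

lemma subordinated_prob_generating_function:
  assumes "prob_space M" and "poisson_process M rate N" and "stable_subordinator M \<alpha> A"
    and "independent_processes M N A" and "0 < \<alpha>" and "0 < rate" and "0 \<le> t" and "\<bar>u\<bar> < 1"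
  shows "(\<lambda>k. subordinated_prob M N A k t * u ^ k) sums
           exp (- t * (rate * (1 - u)) powr \<alpha>)"
proof -
  interpret prob_space M by fact
  note A = stable_subordinator_marginal[OF assms(1,3,5,7)]
  note [measurable] = A(1)
  define q where "q = (\<lambda>k \<omega>. (rate * A t \<omega>) ^ k / fact k * exp (- (rate * A t \<omega>)))"
  have [measurable]: "q k \<in> borel_measurable M" for k
    unfolding q_def by measurable
  have p: "subordinated_prob M N A k t = expectation (q k)" for k
    unfolding subordinated_prob_def q_def
    by (rule poisson_process_random_time_prob[OF assms(1,2,6) A(1,2)])
       (use independent_processes_marginals[OF assms(1,4)] assms in auto)
  \<comment> \<open>Used at \<open>v = u\<close> for the sum itself, at
    \<open>v = \<bar>u\<bar>\<close> for absolute convergence, and at \<open>v = 1\<close> to bound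
    each Poisson weight by the total mass 1.\<close>
  have exp_sums: "(\<lambda>k. q k \<omega> * v ^ k) sums exp (- (rate * (1 - v)) * A t \<omega>)" for v \<omega>
  proof -
    have "(\<lambda>k. (rate * A t \<omega> * v) ^ k /\<^sub>R fact k * exp (- (rate * A t \<omega>))) sums
        (exp (rate * A t \<omega> * v) * exp (- (rate * A t \<omega>)))"
      by (intro sums_mult2 exp_converges)
    then show ?thesis
      by (simp add: q_def mult_exp_exp power_mult_distrib field_simps)
  qed
  have q_nonneg: "0 \<le> q k \<omega>" if "\<omega> \<in> space M" for k \<omega>
    using A(2)[OF that] assms by (simp add: q_def)
  have q_le: "q k \<omega> \<le> 1" if "\<omega> \<in> space M" for k \<omega>
  proof -
    have "(\<lambda>k. q k \<omega>) sums 1" using exp_sums[of \<omega> 1] by simp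
    then show ?thesis
      using sum_le_suminf[of "\<lambda>k. q k \<omega>" "{k}"] q_nonneg[OF that] by (auto simp: sums_iff)
  qed
  have int: "integrable M (\<lambda>\<omega>. q k \<omega> * u ^ k)" for k
    by (intro integrable_mult_left integrable_const_bound[where B = 1] AE_I2)
       (use q_nonneg q_le in auto)
  have "(\<lambda>k. \<integral>\<omega>. q k \<omega> * u ^ k \<partial>M) sums (\<integral>\<omega>. (\<Sum>k. q k \<omega> * u ^ k) \<partial>M)"
  proof (rule sums_integral[OF int])
    show "AE \<omega> in M. summable (\<lambda>k. norm (q k \<omega> * u ^ k))"
      using exp_sums[of _ "\<bar>u\<bar>"] q_nonneg
      by (intro AE_I2) (simp add: sums_iff abs_mult power_abs)
    have "(\<integral>\<omega>. norm (q k \<omega> * u ^ k) \<partial>M) \<le> (\<integral>\<omega>. \<bar>u\<bar> ^ k \<partial>M)" for k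
      by (intro integral_mono integrable_norm int)
         (use q_nonneg q_le in \<open>auto simp: abs_mult power_abs intro!: mult_left_le_one_le\<close>)
    then show "summable (\<lambda>k. \<integral>\<omega>. norm (q k \<omega> * u ^ k) \<partial>M)"
      using \<open>\<bar>u\<bar> < 1\<close>
      by (intro summable_comparison_test'[OF summable_geometric[of "\<bar>u\<bar>"]]) (auto simp: prob_space)
  qed
  also have "(\<integral>\<omega>. (\<Sum>k. q k \<omega> * u ^ k) \<partial>M) = (\<integral>\<omega>. exp (- (rate * (1 - u)) * A t \<omega>) \<partial>M)"
    using exp_sums by (simp add: sums_iff)
  also have "\<dots> = exp (- t * (rate * (1 - u)) powr \<alpha>)"
    using assms by (intro A(3)) auto
  finally show ?thesis by (simp add: p)
qed

section \<open>Uniqueness of formal power series\<close>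

text \<open>Induction applied to \<open>deriv f\<close>, whose expansion is
  \<open>fps_deriv F\<close>; the factor \<open>n + 1\<close> from formal differentiation completes
  the factorial.\<close>

lemma has_fps_expansion_imp_nth_eq:
  fixes f :: "'a :: {banach, real_normed_field} \<Rightarrow> 'a"
  assumes "f has_fps_expansion F"
  shows "F $ n = (deriv ^^ n) f 0 / fact n"
  using assms
proof (induction n arbitrary: f F)
  case 0
  then have "eval_fps F 0 = f 0"
    by (auto simp: has_fps_expansion_def dest: eventually_nhds_x_imp_x)
  then show ?case by (simp add: eval_fps_at_0)
next
  case (Suc n)
  have "fps_deriv F $ n = (deriv ^^ n) (deriv f) 0 / fact n"
    by (rule Suc.IH) (rule has_fps_expansion_deriv[OF Suc.prems])
  moreover have "fps_deriv F $ n = of_nat (Suc n) * F $ Suc n"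
    by simp
  ultimately have "of_nat (Suc n) * F $ Suc n = (deriv ^^ Suc n) f 0 / fact n"
    by (simp only: funpow_Suc_right o_def)
  then show ?case
    by (simp add: eq_divide_eq mult_ac del: of_nat_Suc funpow.simps)
qed

text \<open>The coefficients are derivatives at 0, which depend only on the germ. This turns
  identities between real functions near 0 into identities of formal series.\<close>

lemma has_fps_expansion_unique:
  fixes f :: "'a :: {banach, real_normed_field} \<Rightarrow> 'a"
  assumes "f has_fps_expansion F" and "g has_fps_expansion G"
    and "eventually (\<lambda>u. f u = g u) (nhds 0)"
  shows "F = G"
proof (rule fps_ext)
  fix n
  have "(deriv ^^ n) f 0 = (deriv ^^ n) g 0"
    using assms(3) by (intro higher_deriv_cong_ev refl)
  then show "F $ n = G $ n"
    using assms by (simp add: has_fps_expansion_imp_nth_eq)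
qed

text \<open>Coefficient \<open>m\<close> of the equation expresses \<open>m + 1\<close> times the
  next coefficient through the earlier ones; characteristic 0 allows division by
  \<open>m + 1\<close>.\<close>

lemma fps_linear_ODE_unique:
  fixes A B Q :: "'a :: field_char_0 fps"
  assumes "fps_deriv A = Q * A" and "fps_deriv B = Q * B" and "A $ 0 = B $ 0"
  shows "A = B"
proof (rule fps_ext)
  fix n show "A $ n = B $ n"
  proof (induction n rule: less_induct)
    case (less n)
    show ?case
    proof (cases n)
      case (Suc m)
      have "fps_deriv A $ m = fps_deriv B $ m"
        unfolding assms(1,2) fps_mult_nth using less Suc by (intro sum.cong) auto
      then show ?thesis using Suc by (simp del: of_nat_Suc)
    qed (use assms in simp)
  qed
qed

lemma fps_deriv_binomial:
  "fps_deriv (fps_binomial c) = fps_const c * fps_binomial (c - 1)" for c :: "'a :: field_char_0"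
  \<comment> \<open>Division by \<open>1 + fps_X\<close> is multiplication by the binomial series of
    exponent -1.\<close>
  using fps_binomial_add_mult[of c "-1"]
  by (simp add: fps_binomial_deriv fps_divide_unit fps_binomial_minus_one mult.assoc)

section \<open>The series of (1 - u)^a\<close>

definition one_minus_powr_fps :: "real \<Rightarrow> real fps" where
  "one_minus_powr_fps a = Abs_fps (\<lambda>n. (-1) ^ n * (a gchoose n))"

lemma one_minus_powr_fps_nth: "one_minus_powr_fps a $ n = (-1) ^ n * (a gchoose n)"
  by (simp add: one_minus_powr_fps_def)

lemma one_minus_powr_fps_nth_0 [simp]: "one_minus_powr_fps a $ 0 = 1"
  by (simp add: one_minus_powr_fps_nth)

lemma eventually_abs_less_1: "eventually (\<lambda>u::real. \<bar>u\<bar> < 1) (nhds 0)"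
proof -
  have "eventually (\<lambda>u::real. u \<in> {-1<..<1}) (nhds 0)"
    by (intro eventually_nhds_in_open) auto
  then show ?thesis by eventually_elim auto
qed

lemma has_fps_expansion_one_minus_powr:
  "(\<lambda>u. (1 - u) powr a) has_fps_expansion one_minus_powr_fps a"
proof (rule has_fps_expansionI)
  show "eventually (\<lambda>u. (\<lambda>n. one_minus_powr_fps a $ n * u ^ n) sums (1 - u) powr a) (nhds 0)"
    using eventually_abs_less_1
  proof eventually_elim
    case (elim u)
    have "(\<lambda>n. (a gchoose n) * (- u) ^ n) sums (1 + (- u)) powr a"
      by (rule gen_binomial_real) (use elim in simp)
    then show ?case
      by (simp add: one_minus_powr_fps_nth power_minus[of u] mult_ac)
  qed
qed

text \<open>The law of exponents for real powers is transferred through uniqueness of expansions, in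
  place of a convolution identity for binomial coefficients.\<close>

lemma one_minus_powr_fps_add:
  "one_minus_powr_fps (a + b) = one_minus_powr_fps a * one_minus_powr_fps b"
proof (rule has_fps_expansion_unique)
  show "(\<lambda>u. (1 - u) powr a * (1 - u) powr b) has_fps_expansion
      one_minus_powr_fps a * one_minus_powr_fps b"
    by (intro has_fps_expansion_mult has_fps_expansion_one_minus_powr)
qed (auto intro!: has_fps_expansion_one_minus_powr simp: powr_add)

lemma one_minus_powr_fps_0: "one_minus_powr_fps 0 = 1"
proof (rule fps_ext)
  fix n show "one_minus_powr_fps 0 $ n = 1 $ n"
    by (cases n) (auto simp: one_minus_powr_fps_nth)
qed

lemma one_minus_powr_fps_1: "one_minus_powr_fps 1 = 1 - fps_X"
proof (rule has_fps_expansion_unique[OF has_fps_expansion_one_minus_powr])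
  show "(\<lambda>u::real. 1 - u) has_fps_expansion 1 - fps_X"
    by (intro fps_expansion_intros)
  \<comment> \<open>The power with exponent 1 returns its base when the base is nonnegative, which
    holds near \<open>u = 0\<close>.\<close>
  show "\<forall>\<^sub>F u in nhds 0. (1 - u) powr 1 = 1 - (u::real)"
    using eventually_abs_less_1 by eventually_elim auto
qed

lemma one_minus_powr_fps_power: "one_minus_powr_fps a ^ n = one_minus_powr_fps (of_nat n * a)"
  by (induction n)
     (simp_all add: one_minus_powr_fps_0 ring_distribs one_minus_powr_fps_add)

lemma fps_deriv_one_minus_powr_fps:
  "fps_deriv (one_minus_powr_fps a) = fps_const (- a) * one_minus_powr_fps (a - 1)"
proof (rule has_fps_expansion_unique)
  show "deriv (\<lambda>u. (1 - u) powr a) has_fps_expansion fps_deriv (one_minus_powr_fps a)"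
    by (intro has_fps_expansion_deriv has_fps_expansion_one_minus_powr)
  show "(\<lambda>u. - a * (1 - u) powr (a - 1)) has_fps_expansion
          fps_const (- a) * one_minus_powr_fps (a - 1)"
    by (intro has_fps_expansion_cmult_left has_fps_expansion_one_minus_powr)
  show "\<forall>\<^sub>F u in nhds 0. deriv (\<lambda>u. (1 - u) powr a) u = - a * (1 - u) powr (a - 1)"
    using eventually_abs_less_1
  proof eventually_elim
    case (elim u)
    then have "((\<lambda>u. (1 - u) powr a) has_field_derivative - a * (1 - u) powr (a - 1)) (at u)"
      by (auto intro!: derivative_eq_intros)
    then show ?case by (rule DERIV_imp_deriv)
  qed
qed

text \<open>The formal counterpart of ((1 - u)^a)^b = (1 - u)^(a b), with the base written as
  \<open>1 + V\<close>. Both sides solve Y' = - a b (1 - u)^(-1) Y with constant term 1.\<close>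

lemma fps_binomial_compose_one_minus_powr:
  "fps_binomial b oo (one_minus_powr_fps a - 1) = one_minus_powr_fps (a * b)"
proof -
  define V where "V = one_minus_powr_fps a - 1"
  define Y where "Y = fps_binomial b oo V"
  have V0: "V $ 0 = 0" by (simp add: V_def)
  \<comment> \<open>Since \<open>1 + V\<close> is (1 - u)^a, the power (1 + V)^(b - 1) produced by
    the chain rule equals Y (1 - u)^(-a), which closes the equation for Y.\<close>
  have "Y = (fps_binomial (b - 1) * (1 + fps_X)) oo V"
    using fps_binomial_add_mult[of "b - 1" 1] by (simp add: Y_def fps_binomial_1)
  also have "\<dots> = (fps_binomial (b - 1) oo V) * one_minus_powr_fps a"
    unfolding fps_compose_mult_distrib[OF V0] fps_compose_add_distrib
    using V0 by (simp add: V_def)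
  finally have "Y * one_minus_powr_fps (- a) =
      (fps_binomial (b - 1) oo V) * (one_minus_powr_fps a * one_minus_powr_fps (- a))"
    by (simp add: mult.assoc)
  also have "one_minus_powr_fps a * one_minus_powr_fps (- a) = 1"
    by (simp flip: one_minus_powr_fps_add add: one_minus_powr_fps_0)
  finally have Y: "fps_binomial (b - 1) oo V = Y * one_minus_powr_fps (- a)" by simp
  have V': "fps_deriv V = fps_const (- a) * one_minus_powr_fps (a - 1)"
    by (simp add: V_def fps_deriv_one_minus_powr_fps)
  have "fps_deriv Y = fps_const b * (fps_binomial (b - 1) oo V) * fps_deriv V"
    by (simp add: Y_def fps_compose_deriv[OF V0] fps_deriv_binomial fps_compose_mult_distrib[OF V0])
  also have "\<dots> = fps_const (- a * b) * (one_minus_powr_fps (- a) * one_minus_powr_fps (a - 1)) * Y"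
    unfolding Y V' by (simp add: mult_ac flip: fps_const_mult fps_const_neg)
  also have "one_minus_powr_fps (- a) * one_minus_powr_fps (a - 1) = one_minus_powr_fps (- 1)"
    by (simp flip: one_minus_powr_fps_add)
  finally have 1: "fps_deriv Y = fps_const (- a * b) * one_minus_powr_fps (- 1) * Y" .
  have 2: "fps_deriv (one_minus_powr_fps (a * b)) =
      fps_const (- a * b) * one_minus_powr_fps (- 1) * one_minus_powr_fps (a * b)"
    using one_minus_powr_fps_add[of "-1" "a * b"]
    by (simp add: fps_deriv_one_minus_powr_fps mult.assoc)
  show ?thesis
    using fps_linear_ODE_unique[OF 1 2] by (simp add: Y_def V_def)
qed

section \<open>The series of exp (x (1 - u)^a)\<close>

text \<open>
  The expansion of \<open>exp (x (1 - u)^a)\<close>: the factor \<open>exp x\<close> is split off because formal composition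
  needs an inner series without constant term.
\<close>

definition exp_one_minus_powr_fps :: "real \<Rightarrow> real \<Rightarrow> real fps" where
  "exp_one_minus_powr_fps a x = fps_const (exp x) * (fps_exp x oo (one_minus_powr_fps a - 1))"

text \<open>Each coefficient is \<open>exp x\<close> times a polynomial in \<open>x\<close>, so the
  differentiations and integrations in \<open>x\<close> below reduce to finite sums.\<close>

lemma exp_one_minus_powr_fps_nth:
  "exp_one_minus_powr_fps a x $ k =
     exp x * (\<Sum>i=0..k. x ^ i / fact i * ((one_minus_powr_fps a - 1) ^ i $ k))"
  by (simp add: exp_one_minus_powr_fps_def fps_compose_nth)

text \<open>Both series solve the equation F' = - x a (1 - u)^(a - 1) F in \<open>u\<close>, with
  constant term \<open>exp x\<close>.\<close>

lemma exp_one_minus_powr_fps_unique: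
  assumes F: "(\<lambda>u. exp (x * (1 - u) powr a)) has_fps_expansion F"
  shows "F = exp_one_minus_powr_fps a x"
proof (rule fps_linear_ODE_unique)
  let ?Q = "fps_const (- x * a) * one_minus_powr_fps (a - 1)"
  show "fps_deriv F = ?Q * F"
  proof (rule has_fps_expansion_unique)
    show "deriv (\<lambda>u. exp (x * (1 - u) powr a)) has_fps_expansion fps_deriv F"
      by (rule has_fps_expansion_deriv[OF F])
    show "(\<lambda>u. (- x * a) * (1 - u) powr (a - 1) * exp (x * (1 - u) powr a)) has_fps_expansion ?Q * F"
      by (intro has_fps_expansion_mult has_fps_expansion_cmult_left F
            has_fps_expansion_one_minus_powr)
    show "\<forall>\<^sub>F u in nhds 0. deriv (\<lambda>u. exp (x * (1 - u) powr a)) u =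
        (- x * a) * (1 - u) powr (a - 1) * exp (x * (1 - u) powr a)"
      using eventually_abs_less_1
    proof eventually_elim
      case (elim u)
      then have "((\<lambda>u. exp (x * (1 - u) powr a)) has_field_derivative
          (- x * a) * (1 - u) powr (a - 1) * exp (x * (1 - u) powr a)) (at u)"
        by (auto intro!: derivative_eq_intros)
      then show ?case by (rule DERIV_imp_deriv)
    qed
  qed
  have V0: "(one_minus_powr_fps a - 1) $ 0 = 0" by simp
  show "fps_deriv (exp_one_minus_powr_fps a x) = ?Q * exp_one_minus_powr_fps a x"
    by (simp add: exp_one_minus_powr_fps_def fps_compose_deriv[OF V0] fps_compose_mult_distrib[OF V0]
        fps_deriv_one_minus_powr_fps mult_ac flip: fps_const_mult fps_const_neg)
  show "F $ 0 = exp_one_minus_powr_fps a x $ 0"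
    using has_fps_expansion_imp_nth_eq[OF F, of 0] by (simp add: exp_one_minus_powr_fps_nth)
qed

lemma exp_one_minus_powr_fps_0: "exp_one_minus_powr_fps a 0 = 1"
  by (simp add: exp_one_minus_powr_fps_def)

lemma exp_one_minus_powr_fps_add:
  "exp_one_minus_powr_fps a (x + y) = exp_one_minus_powr_fps a x * exp_one_minus_powr_fps a y"
  by (simp add: exp_one_minus_powr_fps_def fps_exp_add_mult fps_compose_mult_distrib exp_add
      mult_ac flip: fps_const_mult)

section \<open>Derivatives of the coefficients\<close>

lemma exp_one_minus_powr_fps_nth_has_derivative:
  "((\<lambda>x. exp_one_minus_powr_fps a x $ k) has_real_derivative
      (one_minus_powr_fps a * exp_one_minus_powr_fps a x) $ k) (at x within S)"
proof -
  define V where "V = one_minus_powr_fps a - 1"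
  have V0: "V $ 0 = 0" by (simp add: V_def)
  have W: "one_minus_powr_fps a = 1 + V" by (simp add: V_def)
  have nth: "exp_one_minus_powr_fps a x $ k = exp x * (\<Sum>i=0..k. x ^ i / fact i * (V ^ i $ k))" for x
    by (simp add: exp_one_minus_powr_fps_nth V_def)
  \<comment> \<open>In (1 - u)^a = 1 + V, the summand 1 accounts for the derivative of
    \<open>exp x\<close> and V for that of the polynomial factor.\<close>
  have "one_minus_powr_fps a * exp_one_minus_powr_fps a x =
      exp_one_minus_powr_fps a x + fps_const (exp x) * ((fps_X * fps_exp x) oo V)"
    by (simp add: exp_one_minus_powr_fps_def fps_compose_mult_distrib[OF V0] V0
        algebra_simps flip: V_def) (simp add: W algebra_simps)
  then have "(one_minus_powr_fps a * exp_one_minus_powr_fps a x) $ k =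
      exp x * (\<Sum>i=0..k. x ^ i / fact i * (V ^ i $ k)) +
      exp x * (\<Sum>i=0..k. (fps_X * fps_exp x) $ i * (V ^ i $ k))"
    by (simp add: nth fps_compose_nth)
  also have "(\<Sum>i=0..k. (fps_X * fps_exp x) $ i * (V ^ i $ k)) =
      (\<Sum>i=0..k. real i * x ^ (i - 1) / fact i * (V ^ i $ k))"
  proof (intro sum.cong refl)
    \<comment> \<open>At \<open>i = 0\<close> both sides vanish, so the truncated
      \<open>i - 1\<close> does no harm.\<close>
    fix i show "(fps_X * fps_exp x) $ i * (V ^ i $ k) = real i * x ^ (i - 1) / fact i * (V ^ i $ k)"
      by (cases i) (auto simp del: of_nat_Suc)
  qed
  finally have eq: "(one_minus_powr_fps a * exp_one_minus_powr_fps a x) $ k =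
      exp x * (\<Sum>i=0..k. x ^ i / fact i * (V ^ i $ k)) +
      exp x * (\<Sum>i=0..k. real i * x ^ (i - 1) / fact i * (V ^ i $ k))" .
  show ?thesis
    unfolding eq nth by (auto intro!: derivative_eq_intros sum.cong simp: mult_ac)
qed

lemma nth_deriv_on_cong:
  assumes "\<And>x. x \<in> S \<Longrightarrow> f x = g x" and "nth_deriv_on n S f D"
  shows "nth_deriv_on n S g D"
proof (cases n)
  case (Suc m)
  then obtain f' where f': "\<forall>x\<in>S. (f has_real_derivative f' x) (at x within S)"
      "nth_deriv_on m S f' D" using assms by auto
  \<comment> \<open>As \<open>f\<close> and \<open>g\<close> agree on all of \<open>S\<close> and
    derivatives are taken within \<open>S\<close>, any radius \<open>d\<close> works.\<close>
  moreover have "(g has_real_derivative f' x) (at x within S)" if "x \<in> S" for x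
    by (rule has_field_derivative_transform_within[where f = f and d = 1])
       (use f' assms(1) that in auto)
  ultimately show ?thesis using Suc by auto
qed (use assms in auto)

text \<open>Each differentiation multiplies by \<open>b\<close> times (1 - u)^a. The free factor
  \<open>H\<close> absorbs this in the induction and later also carries the multiplier of the
  fractional integral.\<close>

lemma nth_deriv_on_exp_one_minus_powr_fps:
  "nth_deriv_on n S (\<lambda>x. (H * exp_one_minus_powr_fps a (b * x)) $ k)
     (\<lambda>x. (H * fps_const (b ^ n) * one_minus_powr_fps a ^ n * exp_one_minus_powr_fps a (b * x)) $ k)"
proof (induction n arbitrary: H)
  case (Suc n)
  let ?H' = "H * fps_const b * one_minus_powr_fps a"
  have 1: "((\<lambda>x. (H * exp_one_minus_powr_fps a (b * x)) $ k) has_real_derivative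
      (?H' * exp_one_minus_powr_fps a (b * x)) $ k) (at x within S)" for x
  proof -
    have "((\<lambda>x. exp_one_minus_powr_fps a (b * x) $ j) has_real_derivative
        (one_minus_powr_fps a * exp_one_minus_powr_fps a (b * x)) $ j * b) (at x within S)" for j
      by (rule DERIV_chain2[OF exp_one_minus_powr_fps_nth_has_derivative])
         (auto intro!: derivative_eq_intros)
    then have "((\<lambda>x. (H * exp_one_minus_powr_fps a (b * x)) $ k) has_real_derivative
      (\<Sum>i=0..k. H $ i * ((one_minus_powr_fps a * exp_one_minus_powr_fps a (b * x)) $ (k - i) * b)))
      (at x within S)"
      unfolding fps_mult_nth[of H] by (intro DERIV_sum DERIV_cmult)
    also have "(\<Sum>i=0..k. H $ i * ((one_minus_powr_fps a * exp_one_minus_powr_fps a (b * x)) $ (k - i) * b))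
        = (fps_const b * (H * (one_minus_powr_fps a * exp_one_minus_powr_fps a (b * x)))) $ k"
      unfolding fps_mult_left_const_nth fps_mult_nth[of H] sum_distrib_left
      by (intro sum.cong) (auto simp: mult_ac)
    finally show ?thesis by (simp add: mult_ac)
  qed
  have 2: "nth_deriv_on n S (\<lambda>x. (?H' * exp_one_minus_powr_fps a (b * x)) $ k)
     (\<lambda>x. (H * fps_const (b ^ Suc n) * one_minus_powr_fps a ^ Suc n *
        exp_one_minus_powr_fps a (b * x)) $ k)"
    using Suc[of ?H'] by (simp add: mult_ac flip: fps_const_mult)
  show ?case
    unfolding nth_deriv_on.simps
    by (intro exI[of _ "\<lambda>x. (?H' * exp_one_minus_powr_fps a (b * x)) $ k"] conjI ballI 1 2)
qed simp

section \<open>Gamma integrals and fractional integrals\<close>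

lemma has_bochner_integral_powr_exp:
  fixes a c :: real
  assumes "0 < a" and "0 < c"
  shows "has_bochner_integral lborel (\<lambda>y. indicator {0<..} y * (y powr (a - 1) * exp (- c * y)))
           (Gamma a / c powr a)"
proof -
  define g where "g = (\<lambda>t::real. indicator {0..} t * t powr (a - 1) / exp t)"
  have "has_bochner_integral lborel g (Gamma a)"
  proof (rule has_bochner_integral_nn_integral)
    show "(\<integral>\<^sup>+ x. ennreal (g x) \<partial>lborel) = ennreal (Gamma a)"
      using Gamma_conv_nn_integral_real[OF assms(1)] by (simp add: g_def)
  qed (use assms in \<open>auto simp: g_def intro!: Gamma_real_nonneg\<close>)
  then have "has_bochner_integral lborel (\<lambda>y. g (0 + c * y)) (Gamma a /\<^sub>R \<bar>c\<bar>)"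
    using assms by (subst lborel_has_bochner_integral_real_affine_iff[symmetric]) auto
  \<comment> \<open>The factor \<open>c powr (1 - a)\<close> cancels the
    \<open>c powr (a - 1)\<close> arising from the substitution t = c y in Euler's integral.\<close>
  then have "has_bochner_integral lborel (\<lambda>y. c powr (1 - a) * g (c * y)) (c powr (1 - a) * (Gamma a / c))"
    using assms by (intro has_bochner_integral_mult_right) (auto simp: divide_inverse mult.commute)
  also have "c powr (1 - a) * (Gamma a / c) = Gamma a / c powr a"
    using assms by (simp add: powr_diff)
  also have "(\<lambda>y. c powr (1 - a) * g (c * y)) =
      (\<lambda>y. indicator {0<..} y * (y powr (a - 1) * exp (- c * y)))"
  proof
    fix y :: real
    show "c powr (1 - a) * g (c * y) = indicator {0<..} y * (y powr (a - 1) * exp (- c * y))"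
    proof (cases "y > 0")
      case True
      have "c powr (1 - a) * c powr (a - 1) = 1"
        using assms by (simp flip: powr_add)
      then show ?thesis
        using True assms by (simp add: g_def powr_mult exp_minus field_simps indicator_def)
    next
      case False
      \<comment> \<open>At \<open>y = 0\<close> the convention that 0 has power 0 makes the closed
        and open half-lines agree.\<close>
      then show ?thesis using assms
        by (cases "y = 0") (auto simp: g_def indicator_def zero_le_mult_iff)
    qed
  qed
  finally show ?thesis .
qed

text \<open>Formally, Euler's integral at the rate c (1 - u)^a. Termwise integration of the
  polynomial yields the binomial series of exponent \<open>- b\<close> in V, and 1 + V = (1 -
  u)^a.\<close>

lemma has_bochner_integral_powr_exp_one_minus_powr_fps:
  fixes b c :: real
  assumes "0 < b" and "0 < c"
  shows "has_bochner_integral lborel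
      (\<lambda>y. indicator {0<..} y * (y powr (b - 1) * exp_one_minus_powr_fps a (- c * y) $ k))
      (Gamma b * c powr (- b) * one_minus_powr_fps (- a * b) $ k)"
proof -
  define V where "V = one_minus_powr_fps a - 1"
  have "has_bochner_integral lborel
      (\<lambda>y. \<Sum>i=0..k. (- c) ^ i / fact i * (V ^ i $ k) *
             (indicator {0<..} y * (y powr (b + real i - 1) * exp (- c * y))))
      (\<Sum>i=0..k. (- c) ^ i / fact i * (V ^ i $ k) * (Gamma (b + real i) / c powr (b + real i)))"
    using assms
    by (intro has_bochner_integral_sum has_bochner_integral_mult_right has_bochner_integral_powr_exp) auto
  also have "(\<lambda>y. \<Sum>i=0..k. (- c) ^ i / fact i * (V ^ i $ k) *
             (indicator {0<..} y * (y powr (b + real i - 1) * exp (- c * y)))) =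
      (\<lambda>y. indicator {0<..} y * (y powr (b - 1) * exp_one_minus_powr_fps a (- c * y) $ k))"
  proof
    fix y :: real
    have "y powr (b + real i - 1) = y powr (b - 1) * y ^ i" if "y > 0" for i
      using that by (simp add: powr_add powr_diff powr_realpow)
    then show "(\<Sum>i=0..k. (- c) ^ i / fact i * (V ^ i $ k) *
             (indicator {0<..} y * (y powr (b + real i - 1) * exp (- c * y)))) =
      indicator {0<..} y * (y powr (b - 1) * exp_one_minus_powr_fps a (- c * y) $ k)"
      by (cases "y > 0")
         (auto simp: exp_one_minus_powr_fps_nth sum_distrib_left power_mult_distrib mult_ac
            power_minus[of "c * y"] power_minus[of c] indicator_def simp flip: V_def intro!: sum.cong)
  qed
  also have "(\<Sum>i=0..k. (- c) ^ i / fact i * (V ^ i $ k) * (Gamma (b + real i) / c powr (b + real i))) =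
      Gamma b * c powr (- b) * (fps_binomial (- b) oo V) $ k"
    unfolding fps_compose_nth sum_distrib_left
  proof (intro sum.cong refl)
    fix i
    \<comment> \<open>\<open>Gamma (b + real i) / Gamma b\<close> is a rising factorial, and
      together with the sign of \<open>(- c) ^ i\<close> and the factorial it is the binomial
      coefficient of \<open>- b\<close>.\<close>
    have "b \<notin> \<int>\<^sub>\<le>\<^sub>0" using assms by (auto elim!: nonpos_Ints_cases)
    then have "Gamma (b + real i) = pochhammer b i * Gamma b"
      using assms by (simp add: pochhammer_Gamma Gamma_eq_zero_iff)
    moreover have "c powr (b + real i) = c powr b * c ^ i"
      using assms by (simp add: powr_add powr_realpow)
    moreover have "fps_binomial (- b) $ i = (- 1) ^ i * pochhammer b i / fact i"
      by (simp add: gbinomial_pochhammer)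
    ultimately show "(- c) ^ i / fact i * (V ^ i $ k) * (Gamma (b + real i) / c powr (b + real i)) =
        Gamma b * c powr - b * (fps_binomial (- b) $ i * (V ^ i $ k))"
      using assms by (simp add: powr_minus power_minus[of c] field_simps)
  qed
  also have "fps_binomial (- b) oo V = one_minus_powr_fps (- a * b)"
    unfolding V_def by (simp add: fps_binomial_compose_one_minus_powr)
  finally show ?thesis .
qed

text \<open>Substitute s = x + y: by additivity of the exponent the series at s is a Cauchy product
  of the series at x and at y, so the integral from x reduces to the integral from 0.\<close>

lemma has_bochner_integral_fractional_exp_one_minus_powr_fps:
  fixes b c :: real
  assumes "0 < b" and "0 < c"
  shows "has_bochner_integral lborel
      (\<lambda>s. indicator {x<..} s * (exp_one_minus_powr_fps a (- c * s) $ k / (s - x) powr (1 - b)))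
      (Gamma b * c powr (- b) *
         (one_minus_powr_fps (- a * b) * exp_one_minus_powr_fps a (- c * x)) $ k)"
proof -
  let ?E = "exp_one_minus_powr_fps a"
  have "has_bochner_integral lborel
      (\<lambda>y. \<Sum>i=0..k. ?E (- c * x) $ (k - i) *
             (indicator {0<..} y * (y powr (b - 1) * ?E (- c * y) $ i)))
      (\<Sum>i=0..k. ?E (- c * x) $ (k - i) *
             (Gamma b * c powr (- b) * one_minus_powr_fps (- a * b) $ i))"
    by (intro has_bochner_integral_sum has_bochner_integral_mult_right
        has_bochner_integral_powr_exp_one_minus_powr_fps assms)
  also have "(\<Sum>i=0..k. ?E (- c * x) $ (k - i) *
             (Gamma b * c powr (- b) * one_minus_powr_fps (- a * b) $ i)) =
      Gamma b * c powr (- b) * (one_minus_powr_fps (- a * b) * ?E (- c * x)) $ k"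
    unfolding fps_mult_nth sum_distrib_left by (intro sum.cong) auto
  \<comment> \<open>The argument is left as \<open>x + 1 * y\<close> to match the affine change of
    variables with slope 1.\<close>
  also have "(\<lambda>y. \<Sum>i=0..k. ?E (- c * x) $ (k - i) *
             (indicator {0<..} y * (y powr (b - 1) * ?E (- c * y) $ i))) =
      (\<lambda>y. indicator {x<..} (x + 1 * y) *
             (?E (- c * (x + 1 * y)) $ k / ((x + 1 * y) - x) powr (1 - b)))"
  proof
    fix y :: real
    have "?E (- c * (x + 1 * y)) $ k = (\<Sum>i=0..k. ?E (- c * y) $ i * ?E (- c * x) $ (k - i))"
    proof -
      have "- c * (x + 1 * y) = - c * y + - c * x" by (simp add: algebra_simps)
      then show ?thesis by (simp only: exp_one_minus_powr_fps_add fps_mult_nth)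
    qed
    moreover have "1 / y powr (1 - b) = y powr (b - 1)"
      using powr_minus_divide[of y "1 - b"] by simp
    ultimately show "(\<Sum>i=0..k. ?E (- c * x) $ (k - i) *
             (indicator {0<..} y * (y powr (b - 1) * ?E (- c * y) $ i))) =
        indicator {x<..} (x + 1 * y) *
             (?E (- c * (x + 1 * y)) $ k / ((x + 1 * y) - x) powr (1 - b))"
      by (auto simp: indicator_def sum_distrib_left divide_inverse mult_ac intro!: sum.cong)
  qed
  finally show ?thesis
    by (subst lborel_has_bochner_integral_real_affine_iff[of 1 _ _ x]) simp_all
qed

section \<open>The fractional derivative and the equation\<close>

text \<open>The integral of order b = m - 1/a contributes c^(-b) (1 - u)^(-a b), and m derivatives
  contribute (-c)^m (1 - u)^(a m). The signs cancel against (-1)^m, the exponents of 1 - u add up to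
  1, and c^(m - b) = c^(1/a) = l.\<close>

lemma right_frac_deriv_exp_one_minus_powr_fps:
  assumes "0 < a" and "0 < l"
    and f: "\<And>t. 0 \<le> t \<Longrightarrow> f t = exp_one_minus_powr_fps a (- (l powr a) * t) $ k"
  shows "right_frac_deriv (1 / a) f
    (\<lambda>t. l * ((1 - fps_X) * exp_one_minus_powr_fps a (- (l powr a) * t)) $ k)"
proof -
  define c where "c = l powr a"
  define m where "m = nat \<lceil>1 / a\<rceil>"
  define b where "b = real m - 1 / a"
  let ?E = "exp_one_minus_powr_fps a" and ?W = "one_minus_powr_fps"
  have "c > 0" using assms by (simp add: c_def)
  have c_powr: "c powr (1 / a) = l" using assms by (simp add: c_def powr_powr)
  have sign: "(- 1) ^ m * (- c) ^ m = c ^ m"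
    by (simp flip: power_mult_distrib)
  \<comment> \<open>\<open>b = 0\<close> is exactly the integer-order branch of the definition,
    where no integral occurs.\<close>
  show ?thesis
  proof (cases "b = 0")
    case True
    then have m: "1 / a = real m" by (simp add: b_def)
    then have "real m * a = 1" using assms by (simp add: field_simps)
    then have W: "?W a ^ m = 1 - fps_X"
      by (simp add: one_minus_powr_fps_power one_minus_powr_fps_1)
    have "c ^ m = l" using c_powr m \<open>c > 0\<close> by (simp add: powr_realpow)
    have "nth_deriv_on m {0<..} (\<lambda>x. (1 * ?E (- c * x)) $ k)
        (\<lambda>x. (1 * fps_const ((- c) ^ m) * ?W a ^ m * ?E (- c * x)) $ k)"
      by (rule nth_deriv_on_exp_one_minus_powr_fps)
    also have "(\<lambda>x. (1 * fps_const ((- c) ^ m) * ?W a ^ m * ?E (- c * x)) $ k) =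
        (\<lambda>x. (- c) ^ m * ((1 - fps_X) * ?E (- c * x)) $ k)"
      by (simp add: W mult.assoc del: fps_const_power)
    finally have "nth_deriv_on m {0<..} f (\<lambda>x. (- c) ^ m * ((1 - fps_X) * ?E (- c * x)) $ k)"
      by (rule nth_deriv_on_cong[rotated]) (simp add: f c_def)
    moreover have "l * ((1 - fps_X) * ?E (- c * x)) $ k =
        (- 1) ^ m * ((- c) ^ m * ((1 - fps_X) * ?E (- c * x)) $ k)" for x
      using sign \<open>c ^ m = l\<close> by (simp add: mult.assoc[symmetric])
    ultimately show ?thesis
      unfolding right_frac_deriv_def Let_def m_def[symmetric] c_def[symmetric] using m by auto
  next
    case False
    have "1 / a \<le> real m" using assms by (simp add: m_def)
    then have "b > 0" using False by (simp add: b_def)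
    have W: "?W (- a * b) * ?W a ^ m = 1 - fps_X"
    proof -
      have "- a * b + real m * a = 1" using assms by (simp add: b_def field_simps)
      then show ?thesis
        by (simp add: one_minus_powr_fps_power one_minus_powr_fps_1 flip: one_minus_powr_fps_add)
    qed
    have c_m: "c powr (- b) * c ^ m = l"
      using \<open>c > 0\<close> c_powr by (simp add: b_def flip: powr_realpow powr_add)
    \<comment> \<open>Identifies the kernel exponent of the definition with that of the fractional
      integral of order \<open>b\<close>.\<close>
    have order: "1 + 1 / a - real m = 1 - b" by (simp add: b_def)
    let ?g = "\<lambda>x s. f s / (s - x) powr (1 - b)"
    let ?C = "Gamma b * c powr (- b)"
    let ?I = "\<lambda>x. ?C * (?W (- a * b) * ?E (- c * x)) $ k"
    have int: "has_bochner_integral lborel (\<lambda>s. indicator {x<..} s * ?g x s) (?I x)" if "x > 0" for x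
    proof -
      have eq: "(\<lambda>s. indicator {x<..} s * ?g x s) =
          (\<lambda>s. indicator {x<..} s * (?E (- c * s) $ k / (s - x) powr (1 - b)))"
        using that by (auto simp: indicator_def f c_def)
      show ?thesis
        unfolding eq
        by (rule has_bochner_integral_fractional_exp_one_minus_powr_fps[OF \<open>b > 0\<close> \<open>c > 0\<close>])
    qed
    have "nth_deriv_on m {0<..} (\<lambda>x. (fps_const ?C * ?W (- a * b) * ?E (- c * x)) $ k)
        (\<lambda>x. (fps_const ?C * ?W (- a * b) * fps_const ((- c) ^ m) * ?W a ^ m * ?E (- c * x)) $ k)"
      by (rule nth_deriv_on_exp_one_minus_powr_fps)
    also have "(\<lambda>x. (fps_const ?C * ?W (- a * b) * fps_const ((- c) ^ m) * ?W a ^ m * ?E (- c * x)) $ k) =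
        (\<lambda>x. ?C * (- c) ^ m * ((1 - fps_X) * ?E (- c * x)) $ k)"
    proof
      fix x
      have "fps_const ?C * ?W (- a * b) * fps_const ((- c) ^ m) * ?W a ^ m * ?E (- c * x) =
          fps_const (?C * (- c) ^ m) * ((?W (- a * b) * ?W a ^ m) * ?E (- c * x))"
        by (simp add: mult_ac flip: fps_const_mult)
      then show "(fps_const ?C * ?W (- a * b) * fps_const ((- c) ^ m) * ?W a ^ m * ?E (- c * x)) $ k =
          ?C * (- c) ^ m * ((1 - fps_X) * ?E (- c * x)) $ k"
        by (simp only: W fps_mult_left_const_nth)
    qed
    finally have "nth_deriv_on m {0<..} (\<lambda>x. set_lebesgue_integral lborel {x<..} (?g x))
        (\<lambda>x. ?C * (- c) ^ m * ((1 - fps_X) * ?E (- c * x)) $ k)"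
    proof (rule nth_deriv_on_cong[rotated])
      fix x :: real assume "x \<in> {0<..}"
      then show "(fps_const ?C * ?W (- a * b) * ?E (- c * x)) $ k =
          set_lebesgue_integral lborel {x<..} (?g x)"
        using has_bochner_integral_integral_eq[OF int[of x]]
        by (simp add: set_lebesgue_integral_def mult.assoc)
    qed
    moreover have "set_integrable lborel {x<..} (?g x)" if "x > 0" for x
      using int[OF that] by (simp add: set_integrable_def has_bochner_integral_iff)
    moreover have "l * ((1 - fps_X) * ?E (- c * x)) $ k =
        1 / Gamma b * ((- 1) ^ m * (?C * (- c) ^ m * ((1 - fps_X) * ?E (- c * x)) $ k))" for x
    proof -
      have "(- 1) ^ m * (?C * (- c) ^ m) = Gamma b * (c powr (- b) * c ^ m)"
        using sign by (simp add: mult_ac)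
      then show ?thesis
        using c_m Gamma_real_pos[OF \<open>b > 0\<close>] by (simp add: mult.assoc[symmetric])
    qed
    moreover have "1 / a \<noteq> real m" using False by (simp add: b_def)
    ultimately show ?thesis
      unfolding right_frac_deriv_def Let_def m_def[symmetric] c_def[symmetric] order b_def[symmetric]
      by auto
  qed
qed

text \<open>The generating function converges near \<open>u = 0\<close>, hence is an expansion whose
  coefficients are determined uniquely; \<open>rate powr \<alpha>\<close> splits off from the power
  of \<open>rate * (1 - u)\<close>.\<close>

lemma subordinated_prob_eq_exp_one_minus_powr_fps:
  assumes "prob_space M" and "poisson_process M rate N" and "stable_subordinator M \<alpha> A"
    and "independent_processes M N A" and "0 < \<alpha>" and "0 < rate" and "0 \<le> t"
  shows "subordinated_prob M N A k t = exp_one_minus_powr_fps \<alpha> (- (rate powr \<alpha>) * t) $ k"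
proof -
  define F where "F = Abs_fps (\<lambda>k. subordinated_prob M N A k t)"
  have "(\<lambda>u. exp (- (rate powr \<alpha>) * t * (1 - u) powr \<alpha>)) has_fps_expansion F"
  proof (rule has_fps_expansionI)
    show "\<forall>\<^sub>F u in nhds 0.
        (\<lambda>n. F $ n * u ^ n) sums exp (- (rate powr \<alpha>) * t * (1 - u) powr \<alpha>)"
      using eventually_abs_less_1
    proof eventually_elim
      case (elim u)
      have "(rate * (1 - u)) powr \<alpha> = rate powr \<alpha> * (1 - u) powr \<alpha>"
        by (rule powr_mult)
      then show ?case
        using subordinated_prob_generating_function[OF assms elim] by (simp add: F_def mult_ac)
    qed
  qed
  then have "F = exp_one_minus_powr_fps \<alpha> (- (rate powr \<alpha>) * t)"
    by (rule exp_one_minus_powr_fps_unique)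
  then show ?thesis by (simp add: F_def fps_eq_iff)
qed

theorem theorem4:
  fixes M :: "'a measure"
    and N :: "real \<Rightarrow> 'a \<Rightarrow> nat"
    and A :: "real \<Rightarrow> 'a \<Rightarrow> real"
    and \<alpha> rate :: real
  assumes "prob_space M"
    and "0 < \<alpha>" "\<alpha> \<le> 1"
    and "0 < rate"
    and "poisson_process M rate N"
    and "stable_subordinator M \<alpha> A"
    and "independent_processes M N A"
  shows "(\<forall>k. \<exists>D. right_frac_deriv (1 / \<alpha>) (subordinated_prob M N A k) D \<and>
            (\<forall>t>0. D t - rate * (subordinated_prob M N A k t
                            - backward_shift (\<lambda>i. subordinated_prob M N A i t) k) = 0)) \<and>
         subordinated_prob M N A 0 0 = 1 \<and>
         (\<forall>k\<ge>1. subordinated_prob M N A k 0 = 0) \<and>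
         (\<forall>k. \<forall>j\<in>{1..nat \<lfloor>1 / \<alpha>\<rfloor> - 1}. \<exists>E.
            nth_deriv_on j {0..} (subordinated_prob M N A k) E \<and>
            E 0 = (-1) ^ (k + j) * (rate powr (\<alpha> * real j) / fact k)
                  * (Gamma (\<alpha> * real j + 1) / Gamma (\<alpha> * real j + 1 - real k)))"
proof -
  let ?p = "subordinated_prob M N A"
  let ?c = "rate powr \<alpha>"
  let ?E = "\<lambda>t. exp_one_minus_powr_fps \<alpha> (- ?c * t)"
  have p: "?p k t = ?E t $ k" if "0 \<le> t" for k t
    by (rule subordinated_prob_eq_exp_one_minus_powr_fps) (use assms that in auto)
  have "\<exists>D. right_frac_deriv (1 / \<alpha>) (?p k) D \<and>
      (\<forall>t>0. D t - rate * (?p k t - backward_shift (\<lambda>i. ?p i t) k) = 0)" for k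
  proof (intro exI conjI allI impI)
    show "right_frac_deriv (1 / \<alpha>) (?p k) (\<lambda>t. rate * ((1 - fps_X) * ?E t) $ k)"
      by (rule right_frac_deriv_exp_one_minus_powr_fps) (use assms p in auto)
    \<comment> \<open>Multiplication by \<open>1 - fps_X\<close> subtracts the preceding
      coefficient, and nothing when \<open>k = 0\<close>, as in the convention for the backward
      shift.\<close>
    show "rate * ((1 - fps_X) * ?E t) $ k - rate * (?p k t - backward_shift (\<lambda>i. ?p i t) k) = 0"
      if "0 < t" for t
      using that by (simp add: p backward_shift_def left_diff_distrib)
  qed
  moreover have "\<exists>D. nth_deriv_on j {0..} (?p k) D \<and>
      D 0 = (-1) ^ (k + j) * (rate powr (\<alpha> * real j) / fact k)
            * (Gamma (\<alpha> * real j + 1) / Gamma (\<alpha> * real j + 1 - real k))" for k j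
  proof (intro exI conjI)
    let ?D = "\<lambda>t. (1 * fps_const ((- ?c) ^ j) * one_minus_powr_fps \<alpha> ^ j * ?E t) $ k"
    have "nth_deriv_on j {0..} (\<lambda>t. (1 * ?E t) $ k) ?D"
      by (rule nth_deriv_on_exp_one_minus_powr_fps)
    then show "nth_deriv_on j {0..} (?p k) ?D"
      by (rule nth_deriv_on_cong[rotated]) (simp add: p)
    have "\<alpha> * real j + 1 > 0" using assms by (simp add: add_nonneg_pos)
    then have "\<alpha> * real j + 1 \<notin> \<int>\<^sub>\<le>\<^sub>0" by (auto elim!: nonpos_Ints_cases)
    \<comment> \<open>If the lower Gamma is at a pole, its value 0 and division by 0 give 0, in
      agreement with the vanishing binomial coefficient.\<close>
    then have "(\<alpha> * real j) gchoose k =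
        Gamma (\<alpha> * real j + 1) / (fact k * Gamma (\<alpha> * real j + 1 - real k))"
      by (subst gbinomial_Gamma) (simp_all add: algebra_simps)
    \<comment> \<open>This contributes (-1)^j to the sign, beside the (-1)^k of the series
      coefficient: already p_0(t) = exp (- c t) has derivative - c at 0.\<close>
    moreover have "(- ?c) ^ j = (- 1) ^ j * rate powr (\<alpha> * real j)"
      using assms by (simp add: power_minus[of ?c] powr_powr flip: powr_realpow)
    ultimately show "?D 0 = (-1) ^ (k + j) * (rate powr (\<alpha> * real j) / fact k)
        * (Gamma (\<alpha> * real j + 1) / Gamma (\<alpha> * real j + 1 - real k))"
      by (simp add: exp_one_minus_powr_fps_0 one_minus_powr_fps_power one_minus_powr_fps_nth
          power_add mult_ac del: fps_const_power)
  qed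
  \<comment> \<open>At time 0 the series is 1, whose coefficients are the initial values.\<close>
  ultimately show ?thesis
    using p[of 0] by (simp add: exp_one_minus_powr_fps_0)
qed

end
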